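(* Let $a > b > 0$ and let $\mathsf{A} = \{(x_1,x_2)\in\mathbb{R}^2 : x_1^2/a^2 + x_2^2/b^2 - 1 < 0\}$ be the elliptical disc with major and minor semi-axes $a$ and $b$, with eccentricity $\varepsilon = \sqrt{1-b^2/a^2}$. Let $\alpha = (\alpha_0,\alpha_1,\alpha_2)\in\mathbb{R}^3$ and let $\sigma(\mathbf{x}) = \alpha_0 + \alpha_1 x_1/a + \alpha_2 x_2/b$ for $\mathbf{x} = (x_1,x_2)\in\mathsf{A}$ be the distribution of charges over $\mathsf{A}$. Then the corresponding electrostatic energy $$I_\sigma = \int_{\mathsf{A}} \frac{1}{4\pi}\int_{\mathsf{A}} \frac{\overline{\sigma(\mathbf{x})}\,\sigma(\mathbf{y})}{|\mathbf{x}-\mathbf{y}|}\, ds_{\mathbf{x}}\, ds_{\mathbf{y}}$$ is given by $$I_\sigma = \frac{8ab^2}{15\pi}\left[\left(5\alpha_0^2+\alpha_2^2\right)K(\varepsilon) + \left(\alpha_1^2-\alpha_2^2\right)\frac{K(\varepsilon)-E(\varepsilon)}{\varepsilon^2}\right],$$ where $$K(\varepsilon) = \int_0^{\pi/2}\frac{d\phi}{\sqrt{1-\varepsilon^2\sin^2\phi}}\quad\text{and}\quad E(\varepsilon) = \int_0^{\pi/2}\sqrt{1-\varepsilon^2\sin^2\phi}\,d\phi.$$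
   Context: Here $ds_{\mathbf{x}}$ and $ds_{\mathbf{y}}$ denote the two-dimensional area (Lebesgue) measure on $\mathsf{A}\subset\mathbb{R}^2$, and $|\mathbf{x}-\mathbf{y}|$ is the Euclidean distance in the plane. The electrostatic potential generated by the density $\sigma$ on $\mathsf{A}$ is $f(\mathbf{x}) = \frac{1}{4\pi}\int_{\mathsf{A}}\frac{\sigma(\mathbf{y})}{|\mathbf{x}-\mathbf{y}|}\,ds_{\mathbf{y}}$ for $\mathbf{x}\in\mathsf{A}$ (units chosen so that the electric permittivity of air is $1$), and the energy is equivalently $I_\sigma = \int_{\mathsf{A}} f(\mathbf{x})\,\overline{\sigma(\mathbf{x})}\,ds_{\mathbf{x}}$. $K$ and $E$ are the complete elliptic integrals of the first and second kind, as functions of the modulus $\varepsilon$. *)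

theory Defs
  imports "HOL-Analysis.Analysis"
begin

definition elliptic_disc :: "real \<Rightarrow> real \<Rightarrow> (real ^ 2) set" where
  "elliptic_disc a b = {x. (x $ 1)\<^sup>2 / a\<^sup>2 + (x $ 2)\<^sup>2 / b\<^sup>2 - 1 < 0}"

definition eccentricity :: "real \<Rightarrow> real \<Rightarrow> real" where
  "eccentricity a b = sqrt (1 - b\<^sup>2 / a\<^sup>2)"

definition affine_charge ::
    "real \<Rightarrow> real \<Rightarrow> real \<Rightarrow> real \<Rightarrow> real \<Rightarrow> real ^ 2 \<Rightarrow> real" where
  "affine_charge a b \<alpha>0 \<alpha>1 \<alpha>2 x = \<alpha>0 + \<alpha>1 * (x $ 1) / a + \<alpha>2 * (x $ 2) / b"

(* The energy is an iterated integral: the inner integration is over x, the outer over y.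
   The integrand is only undefined on the diagonal, where division by zero gives 0;
   for fixed y this is a null set of x. *)
definition electrostatic_energy ::
    "(real ^ 2) set \<Rightarrow> (real ^ 2 \<Rightarrow> complex) \<Rightarrow> complex" where
  "electrostatic_energy A \<sigma> =
     (LINT y:A|lebesgue. 1 / (4 * complex_of_real pi) *
       (LINT x:A|lebesgue. cnj (\<sigma> x) * \<sigma> y / complex_of_real (dist x y)))"

(* Complete elliptic integrals as functions of the modulus (not of the parameter, its square). *)
definition elliptic_K :: "real \<Rightarrow> real" where
  "elliptic_K \<epsilon> = integral {0..pi / 2} (\<lambda>\<phi>. 1 / sqrt (1 - \<epsilon>\<^sup>2 * (sin \<phi>)\<^sup>2))"

definition elliptic_E :: "real \<Rightarrow> real" where
  "elliptic_E \<epsilon> = integral {0..pi / 2} (\<lambda>\<phi>. sqrt (1 - \<epsilon>\<^sup>2 * (sin \<phi>)\<^sup>2))"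

end

theory Submission
  imports Defs
begin

text \<open>
  Rescaled to the unit disc, the energy is a double integral against the kernel
  \<open>1 / sqrt (a\<^sup>2 (x\<^sub>1 - y\<^sub>1)\<^sup>2 + b\<^sup>2 (x\<^sub>2 - y\<^sub>2)\<^sup>2)\<close>. Parametrise a pair of
  points by the line \<open>x\<^sub>2 = c + m x\<^sub>1\<close> through them and their two abscissae \<open>t\<close>, \<open>s\<close>: the Jacobian
  \<open>\<bar>t - s\<bar>\<close> cancels the singularity and leaves the weight \<open>1 / sqrt (a\<^sup>2 + b\<^sup>2 m\<^sup>2)\<close>.
  On each line the integrals over \<open>t\<close> and \<open>s\<close> decouple into the square of the integral of the
  affine density over a chord, that is, chord length times the value at the midpoint. Integration
  over \<open>c\<close> is then polynomial, and \<open>m = tan \<phi>\<close> turns the integral over \<open>m\<close> into complete elliptic integrals.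
\<close>

subsection \<open>Integration over pairs of points on lines\<close>

lemma borel_measurable_fst_snd [measurable]:
  "(fst :: 'a::second_countable_topology \<times> 'b::second_countable_topology \<Rightarrow> 'a) \<in> borel_measurable borel"
  "(snd :: 'a::second_countable_topology \<times> 'b::second_countable_topology \<Rightarrow> 'b) \<in> borel_measurable borel"
  by (simp_all add: borel_prod[symmetric])

lemma nn_integral_lborel_pair:
  fixes F :: "'a::euclidean_space \<times> 'b::euclidean_space \<Rightarrow> ennreal"
  assumes [measurable]: "F \<in> borel_measurable borel"
  shows "(\<integral>\<^sup>+z. F z \<partial>lborel) = (\<integral>\<^sup>+x. \<integral>\<^sup>+y. F (x, y) \<partial>lborel \<partial>lborel)"
  by (subst lborel_prod[symmetric], subst lborel.nn_integral_fst[symmetric])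
     (simp_all add: lborel_prod)

lemma nn_integral_lborel_pair_pair:
  fixes F :: "('a::euclidean_space \<times> 'b::euclidean_space) \<times> ('c::euclidean_space \<times> 'd::euclidean_space) \<Rightarrow> ennreal"
  assumes [measurable]: "F \<in> borel_measurable borel"
  shows "(\<integral>\<^sup>+z. F z \<partial>lborel) =
    (\<integral>\<^sup>+x1. \<integral>\<^sup>+x2. \<integral>\<^sup>+y1. \<integral>\<^sup>+y2. F ((x1, x2), (y1, y2)) \<partial>lborel \<partial>lborel \<partial>lborel \<partial>lborel)"
  by (subst nn_integral_lborel_pair, simp)+ simp

lemma nn_integral_lborel_swap:
  fixes F :: "'a::euclidean_space \<Rightarrow> 'b::euclidean_space \<Rightarrow> ennreal"
  assumes "case_prod F \<in> borel_measurable borel"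
  shows "(\<integral>\<^sup>+x. \<integral>\<^sup>+y. F x y \<partial>lborel \<partial>lborel) = (\<integral>\<^sup>+y. \<integral>\<^sup>+x. F x y \<partial>lborel \<partial>lborel)"
  using assms by (intro lborel_pair.Fubini'[symmetric]) (simp add: lborel_prod)

text \<open>The substitution \<open>y = x + m * u\<close> has Jacobian \<open>\<bar>u\<bar>\<close>,
  and the radicand becomes \<open>u^2 * (a^2 + b^2 * m^2)\<close>, so the two factors
  \<open>\<bar>u\<bar>\<close> cancel. In the application \<open>u\<close> is the difference of two
  abscissae and \<open>m\<close> the slope of the joining line.\<close>

lemma nn_integral_kernel_slope:
  fixes f :: "real \<Rightarrow> ennreal" and a b u x :: real
  assumes [measurable]: "f \<in> borel_measurable borel" and "u \<noteq> 0"
  shows "(\<integral>\<^sup>+y. f y * ennreal (1 / sqrt (a\<^sup>2 * u\<^sup>2 + b\<^sup>2 * (x - y)\<^sup>2)) \<partial>lborel) =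
         (\<integral>\<^sup>+m. f (x + m * u) * ennreal (1 / sqrt (a\<^sup>2 + b\<^sup>2 * m\<^sup>2)) \<partial>lborel)"
proof -
  have *: "sqrt (a\<^sup>2 * u\<^sup>2 + b\<^sup>2 * (u * m)\<^sup>2) = \<bar>u\<bar> * sqrt (a\<^sup>2 + b\<^sup>2 * m\<^sup>2)" for m
  proof -
    have "a\<^sup>2 * u\<^sup>2 + b\<^sup>2 * (u * m)\<^sup>2 = u\<^sup>2 * (a\<^sup>2 + b\<^sup>2 * m\<^sup>2)"
      by (simp add: power_mult_distrib algebra_simps)
    then show ?thesis by (simp add: real_sqrt_mult)
  qed
  have **: "ennreal \<bar>u\<bar> * ennreal (1 / (\<bar>u\<bar> * r)) = ennreal (1 / r)" if "r \<ge> 0" for r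
    using \<open>u \<noteq> 0\<close> that by (subst ennreal_mult[symmetric]) auto
  have "(\<integral>\<^sup>+y. f y * ennreal (1 / sqrt (a\<^sup>2 * u\<^sup>2 + b\<^sup>2 * (x - y)\<^sup>2)) \<partial>lborel) =
      (\<integral>\<^sup>+m. f (x + u * m) * (ennreal \<bar>u\<bar> * ennreal (1 / (\<bar>u\<bar> * sqrt (a\<^sup>2 + b\<^sup>2 * m\<^sup>2)))) \<partial>lborel)"
    using \<open>u \<noteq> 0\<close>
    by (subst nn_integral_real_affine[where c=u and t=x])
       (simp_all add: nn_integral_cmult[symmetric] *[symmetric] mult.left_commute)
  then show ?thesis
    by (simp add: ** mult.commute)
qed

text \<open>Two one-dimensional affine substitutions inside iterated integrals replace a
  four-dimensional Jacobian: first \<open>y2\<close> gives way to the slope \<open>m\<close>, then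
  \<open>x2\<close> to the intercept \<open>c\<close>. As the integrand is nonnegative, every
  interchange is Tonelli.\<close>

lemma nn_integral_kernel_lines:
  fixes f :: "(real \<times> real) \<times> (real \<times> real) \<Rightarrow> ennreal" and a b :: real
  assumes [measurable]: "f \<in> borel_measurable borel"
  shows "(\<integral>\<^sup>+((x1, x2), (y1, y2)).
            f ((x1, x2), (y1, y2)) * ennreal (1 / sqrt (a\<^sup>2 * (x1 - y1)\<^sup>2 + b\<^sup>2 * (x2 - y2)\<^sup>2)) \<partial>lborel) =
         (\<integral>\<^sup>+((m, c), (t, s)).
            f ((t, c + m * t), (s, c + m * s)) * ennreal (1 / sqrt (a\<^sup>2 + b\<^sup>2 * m\<^sup>2)) \<partial>lborel)"
    (is "?L = ?R")
proof -
  let ?w = "\<lambda>m. ennreal (1 / sqrt (a\<^sup>2 + b\<^sup>2 * m\<^sup>2))"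
  have "?L = (\<integral>\<^sup>+x1. \<integral>\<^sup>+x2. \<integral>\<^sup>+y1. \<integral>\<^sup>+y2. 
      f ((x1, x2), (y1, y2)) * ennreal (1 / sqrt (a\<^sup>2 * (x1 - y1)\<^sup>2 + b\<^sup>2 * (x2 - y2)\<^sup>2)) \<partial>lborel \<partial>lborel \<partial>lborel \<partial>lborel)"
    by (simp add: nn_integral_lborel_pair_pair split_beta')
  also have "\<dots> = (\<integral>\<^sup>+x1. \<integral>\<^sup>+x2. \<integral>\<^sup>+y1. \<integral>\<^sup>+m. 
      f ((x1, x2), (y1, x2 + m * (y1 - x1))) * ?w m \<partial>lborel \<partial>lborel \<partial>lborel \<partial>lborel)"
  proof (rule nn_integral_cong, rule nn_integral_cong)
    fix x1 x2 :: real
    \<comment> \<open>Vertical lines have no slope, but for fixed \<open>x1\<close> they account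
      only for the null set \<open>y1 = x1\<close>.\<close>
    have "AE y1 in lborel. y1 \<noteq> x1" using AE_lborel_singleton[of x1] by simp
    then have "AE y1 in lborel. (\<integral>\<^sup>+y2. f ((x1, x2), (y1, y2)) *
        ennreal (1 / sqrt (a\<^sup>2 * (x1 - y1)\<^sup>2 + b\<^sup>2 * (x2 - y2)\<^sup>2)) \<partial>lborel) =
      (\<integral>\<^sup>+m. f ((x1, x2), (y1, x2 + m * (y1 - x1))) * ?w m \<partial>lborel)"
    proof eventually_elim
      case (elim y1)
      then show ?case
        using nn_integral_kernel_slope[of "\<lambda>y2. f ((x1, x2), (y1, y2))" "y1 - x1" a b x2]
        by (simp add: power2_commute[of x1 y1])
    qed
    then show "(\<integral>\<^sup>+y1. \<integral>\<^sup>+y2. f ((x1, x2), (y1, y2)) *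
        ennreal (1 / sqrt (a\<^sup>2 * (x1 - y1)\<^sup>2 + b\<^sup>2 * (x2 - y2)\<^sup>2)) \<partial>lborel \<partial>lborel) =
      (\<integral>\<^sup>+y1. \<integral>\<^sup>+m. f ((x1, x2), (y1, x2 + m * (y1 - x1))) * ?w m \<partial>lborel \<partial>lborel)"
      by (rule nn_integral_cong_AE)
  qed
  \<comment> \<open>Three interchanges move \<open>m\<close> outermost. For fixed \<open>m\<close>
    and \<open>x1\<close>, passing from \<open>x2\<close> to \<open>c = x2 - m * x1\<close> is then
    a mere translation, and it turns \<open>x2 + m * (y1 - x1)\<close> into
    \<open>c + m * y1\<close>.\<close>
  also have "\<dots> = (\<integral>\<^sup>+x1. \<integral>\<^sup>+x2. \<integral>\<^sup>+m. \<integral>\<^sup>+y1.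
      f ((x1, x2), (y1, x2 + m * (y1 - x1))) * ?w m \<partial>lborel \<partial>lborel \<partial>lborel \<partial>lborel)"
    by (intro nn_integral_cong nn_integral_lborel_swap) simp
  also have "\<dots> = (\<integral>\<^sup>+x1. \<integral>\<^sup>+m. \<integral>\<^sup>+x2. \<integral>\<^sup>+y1.
      f ((x1, x2), (y1, x2 + m * (y1 - x1))) * ?w m \<partial>lborel \<partial>lborel \<partial>lborel \<partial>lborel)"
    by (intro nn_integral_cong nn_integral_lborel_swap) simp
  also have "\<dots> = (\<integral>\<^sup>+m. \<integral>\<^sup>+x1. \<integral>\<^sup>+x2. \<integral>\<^sup>+y1.
      f ((x1, x2), (y1, x2 + m * (y1 - x1))) * ?w m \<partial>lborel \<partial>lborel \<partial>lborel \<partial>lborel)"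
    by (intro nn_integral_lborel_swap) simp
  also have "\<dots> = (\<integral>\<^sup>+m. \<integral>\<^sup>+x1. \<integral>\<^sup>+c. \<integral>\<^sup>+y1.
      f ((x1, c + m * x1), (y1, c + m * y1)) * ?w m \<partial>lborel \<partial>lborel \<partial>lborel \<partial>lborel)"
  proof (rule nn_integral_cong, rule nn_integral_cong)
    fix m x1 :: real
    show "(\<integral>\<^sup>+x2. \<integral>\<^sup>+y1. f ((x1, x2), (y1, x2 + m * (y1 - x1))) * ?w m \<partial>lborel \<partial>lborel) =
      (\<integral>\<^sup>+c. \<integral>\<^sup>+y1. f ((x1, c + m * x1), (y1, c + m * y1)) * ?w m \<partial>lborel \<partial>lborel)"
      by (subst nn_integral_real_affine[where c=1 and t="m * x1"]) (simp_all add: algebra_simps)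
  qed
  also have "\<dots> = (\<integral>\<^sup>+m. \<integral>\<^sup>+c. \<integral>\<^sup>+x1. \<integral>\<^sup>+y1.
      f ((x1, c + m * x1), (y1, c + m * y1)) * ?w m \<partial>lborel \<partial>lborel \<partial>lborel \<partial>lborel)"
    by (intro nn_integral_cong nn_integral_lborel_swap) simp
  also have "\<dots> = ?R"
    by (simp add: nn_integral_lborel_pair_pair split_beta')
  finally show ?thesis .
qed

text \<open>The nonnegative identity is applied to the norm, which carries integrability from line
  coordinates back to pairs of points, and to the positive and negative parts, which gives the
  value.\<close>

lemma
  fixes G :: "(real \<times> real) \<times> (real \<times> real) \<Rightarrow> real" and a b :: real
  assumes [measurable]: "G \<in> borel_measurable borel"
  assumes int: "integrable lborel
    (\<lambda>((m, c), (t, s)). G ((t, c + m * t), (s, c + m * s)) * (1 / sqrt (a\<^sup>2 + b\<^sup>2 * m\<^sup>2)))"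
  shows integrable_kernel_lines: "integrable lborel (\<lambda>((x1, x2), (y1, y2)).
            G ((x1, x2), (y1, y2)) * (1 / sqrt (a\<^sup>2 * (x1 - y1)\<^sup>2 + b\<^sup>2 * (x2 - y2)\<^sup>2)))" (is "integrable _ ?k")
    and integral_kernel_lines: "(\<integral>((x1, x2), (y1, y2)).
            G ((x1, x2), (y1, y2)) * (1 / sqrt (a\<^sup>2 * (x1 - y1)\<^sup>2 + b\<^sup>2 * (x2 - y2)\<^sup>2)) \<partial>lborel) =
         (\<integral>((m, c), (t, s)).
            G ((t, c + m * t), (s, c + m * s)) * (1 / sqrt (a\<^sup>2 + b\<^sup>2 * m\<^sup>2)) \<partial>lborel)" (is "_ = integral\<^sup>L _ ?w")
proof -
  \<comment> \<open>Since \<open>ennreal\<close> sends negative reals to 0, the identity and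
    \<open>uminus\<close> yield the positive and negative parts. All three choices of
    \<open>h\<close> are positively homogeneous, so the nonnegative weight can be pulled
    out.\<close>
  have *: "(\<integral>\<^sup>+z. ennreal (h (?k z)) \<partial>lborel) = (\<integral>\<^sup>+z. ennreal (h (?w z)) \<partial>lborel)"
    if h: "h \<in> {norm, (\<lambda>x. x), uminus}" for h :: "real \<Rightarrow> real"
  proof -
    have [measurable]: "h \<in> borel_measurable borel"
      using h by auto
    have h': "ennreal (h (x * (1 / y))) = ennreal (h x) * ennreal (1 / y)" if "y \<ge> 0" for x y
      using h that by (auto simp: ennreal_mult''[symmetric] abs_mult simp del: times_divide_eq_right)
    show ?thesis
      using nn_integral_kernel_lines[of "\<lambda>z. ennreal (h (G z))" a b]
      by (simp add: split_beta' h' del: times_divide_eq_right)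
  qed
  show int': "integrable lborel ?k"
  proof -
    have "?k \<in> borel_measurable lborel"
      by (simp add: split_beta')
    then show ?thesis
      using int *[of norm] by (simp add: integrable_iff_bounded del: times_divide_eq_right)
  qed
  show "integral\<^sup>L lborel ?k = integral\<^sup>L lborel ?w"
    using *[of "\<lambda>x. x"] *[of uminus]
    unfolding real_lebesgue_integral_def[OF int] real_lebesgue_integral_def[OF int'] by simp
qed

subsection \<open>Chords of the unit disc\<close>

text \<open>For lines missing the disc, \<open>l\<close> is nonpositive because \<open>sqrt\<close> is odd, so the interval is empty.\<close>

lemma chord_unit_disc:
  fixes m c :: real
  defines "l \<equiv> sqrt (1 + m\<^sup>2 - c\<^sup>2) / (1 + m\<^sup>2)" and "r \<equiv> - c * m / (1 + m\<^sup>2)"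
  shows "{t. t\<^sup>2 + (c + m * t)\<^sup>2 < 1} = {r - l<..<r + l}"
proof -
  have pos: "1 + m\<^sup>2 > 0" by (simp add: add_pos_nonneg)
  have "t\<^sup>2 + (c + m * t)\<^sup>2 < 1 \<longleftrightarrow> t \<in> {r - l<..<r + l}" for t
  proof -
    \<comment> \<open>Multiplying by \<open>1 + m^2\<close> completes the square in
      \<open>t\<close>, centred at \<open>r\<close>.\<close>
    have "t\<^sup>2 + (c + m * t)\<^sup>2 < 1 \<longleftrightarrow> (1 + m\<^sup>2) * (t\<^sup>2 + (c + m * t)\<^sup>2 - 1) < 0"
      using pos by (simp add: mult_less_0_iff)
    also have "(1 + m\<^sup>2) * (t\<^sup>2 + (c + m * t)\<^sup>2 - 1) = ((1 + m\<^sup>2) * t + c * m)\<^sup>2 - (1 + m\<^sup>2 - c\<^sup>2)"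
      by algebra
    \<comment> \<open>\<open>sqrt\<close> is strictly increasing on all reals, so the comparison
      also covers a negative \<open>1 + m^2 - c^2\<close>.\<close>
    also have "\<dots> < 0 \<longleftrightarrow> sqrt (((1 + m\<^sup>2) * t + c * m)\<^sup>2) < sqrt (1 + m\<^sup>2 - c\<^sup>2)"
      by (subst real_sqrt_less_iff) simp
    also have "\<dots> \<longleftrightarrow> \<bar>(1 + m\<^sup>2) * t + c * m\<bar> < sqrt (1 + m\<^sup>2 - c\<^sup>2)"
      by simp
    also have "(1 + m\<^sup>2) * t + c * m = (1 + m\<^sup>2) * (t - r)"
      using pos by (simp add: r_def distrib_left)
    also have "\<bar>(1 + m\<^sup>2) * (t - r)\<bar> < sqrt (1 + m\<^sup>2 - c\<^sup>2) \<longleftrightarrow> \<bar>t - r\<bar> < l"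
      using pos by (simp add: l_def abs_mult pos_less_divide_eq mult.commute)
    also have "\<dots> \<longleftrightarrow> t \<in> {r - l<..<r + l}"
      by auto
    finally show ?thesis .
  qed
  then show ?thesis by blast
qed

text \<open>The mean of an affine function over an interval is its value at the midpoint.\<close>

lemma integral_affine_Ioo:
  fixes p q r l :: real
  assumes "l \<ge> 0"
  shows "(\<integral>t. indicator {r - l<..<r + l} t * (p + q * t) \<partial>lborel) = 2 * l * (p + q * r)"
proof -
  have "(\<integral>t. indicator {r - l<..<r + l} t * (p + q * t) \<partial>lborel) =
      (\<integral>t. (p + q * t) * indicator {r - l..r + l} t \<partial>lborel)"
  proof (rule integral_cong_AE)
    show "AE t in lborel. indicator {r - l<..<r + l} t * (p + q * t) = (p + q * t) * indicator {r - l..r + l} t"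
      using AE_lborel_singleton[of "r - l"] AE_lborel_singleton[of "r + l"]
      by eventually_elim (auto split: split_indicator)
  qed simp_all
  also have "\<dots> = (p * (r + l) + q * (r + l)\<^sup>2 / 2) - (p * (r - l) + q * (r - l)\<^sup>2 / 2)"
    by (rule integral_FTC_Icc_real)
       (use assms in \<open>auto intro!: derivative_eq_intros continuous_intros\<close>)
  also have "\<dots> = 2 * l * (p + q * r)"
    by (simp add: power2_eq_square field_simps)
  finally show ?thesis .
qed

text \<open>The charge density of the ellipse pulled back by the scaling
  \<open>(p, q) \<mapsto> (a * p, b * q)\<close> and extended by zero, so that all integrals can run
  over the whole plane.\<close>

definition disc_charge :: "real \<Rightarrow> real \<Rightarrow> real \<Rightarrow> real \<times> real \<Rightarrow> real" where
  "disc_charge \<alpha>0 \<alpha>1 \<alpha>2 p =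
     indicator {p. (fst p)\<^sup>2 + (snd p)\<^sup>2 < 1} p * (\<alpha>0 + \<alpha>1 * fst p + \<alpha>2 * snd p)"

lemma borel_measurable_disc_charge [measurable]: "disc_charge \<alpha>0 \<alpha>1 \<alpha>2 \<in> borel_measurable borel"
  unfolding disc_charge_def by measurable

text \<open>The midpoint of the chord is \<open>(- c * m, c) / (1 + m^2)\<close>, where the density
  equals \<alpha>0 + c (\<alpha>2 - \<alpha>1 m) / (1 + m^2). The factor in front is the length of
  the chord projected to the first axis, because the integration variable is the abscissa.\<close>

lemma integral_disc_charge_chord:
  fixes m c :: real
  shows "(\<integral>t. disc_charge \<alpha>0 \<alpha>1 \<alpha>2 (t, c + m * t) \<partial>lborel) =
    (if c\<^sup>2 \<le> 1 + m\<^sup>2 then 2 * sqrt (1 + m\<^sup>2 - c\<^sup>2) / (1 + m\<^sup>2) * (\<alpha>0 + c * (\<alpha>2 - \<alpha>1 * m) / (1 + m\<^sup>2)) else 0)"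
proof -
  define l r where "l = sqrt (1 + m\<^sup>2 - c\<^sup>2) / (1 + m\<^sup>2)" and "r = - c * m / (1 + m\<^sup>2)"
  have pos: "1 + m\<^sup>2 > 0" by (simp add: add_pos_nonneg)
  have "disc_charge \<alpha>0 \<alpha>1 \<alpha>2 (t, c + m * t) =
    indicator {r - l<..<r + l} t * ((\<alpha>0 + \<alpha>2 * c) + (\<alpha>1 + \<alpha>2 * m) * t)" for t
  proof -
    have "t \<in> {t. t\<^sup>2 + (c + m * t)\<^sup>2 < 1} \<longleftrightarrow> t \<in> {r - l<..<r + l}"
      unfolding chord_unit_disc l_def r_def ..
    moreover have "\<alpha>0 + \<alpha>1 * t + \<alpha>2 * (c + m * t) = (\<alpha>0 + \<alpha>2 * c) + (\<alpha>1 + \<alpha>2 * m) * t"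
      by algebra
    ultimately show ?thesis
      by (simp add: disc_charge_def indicator_def)
  qed
  then have eq: "(\<integral>t. disc_charge \<alpha>0 \<alpha>1 \<alpha>2 (t, c + m * t) \<partial>lborel) =
    (\<integral>t. indicator {r - l<..<r + l} t * ((\<alpha>0 + \<alpha>2 * c) + (\<alpha>1 + \<alpha>2 * m) * t) \<partial>lborel)"
    by simp
  show ?thesis
  proof (cases "c\<^sup>2 \<le> 1 + m\<^sup>2")
    case True
    then have "l \<ge> 0" by (simp add: l_def)
    moreover have "(\<alpha>0 + \<alpha>2 * c) + (\<alpha>1 + \<alpha>2 * m) * r = \<alpha>0 + c * (\<alpha>2 - \<alpha>1 * m) / (1 + m\<^sup>2)"
    proof -
      have "(\<alpha>0 + \<alpha>2 * c) + (\<alpha>1 + \<alpha>2 * m) * r =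
          \<alpha>0 + (c * \<alpha>2 * (1 + m\<^sup>2) + (\<alpha>1 + \<alpha>2 * m) * (- c * m)) / (1 + m\<^sup>2)"
        using pos by (simp add: r_def diff_divide_distrib mult.commute[of \<alpha>2 c])
      also have "c * \<alpha>2 * (1 + m\<^sup>2) + (\<alpha>1 + \<alpha>2 * m) * (- c * m) = c * (\<alpha>2 - \<alpha>1 * m)"
        by algebra
      finally show ?thesis .
    qed
    ultimately show ?thesis
      using True unfolding eq by (subst integral_affine_Ioo) (simp_all add: l_def)
  next
    case False
    then have "l \<le> 0" using pos by (simp add: l_def divide_nonpos_pos)
    then have "{r - l<..<r + l} = {}" by auto
    with False show ?thesis unfolding eq by simp
  qed
qed

text \<open>To be used with \<open>w = sqrt (1 + m^2)\<close>, \<open>p\<close> = \<alpha>0 and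
  \<open>q\<close> = \<alpha>2 - \<alpha>1 m. The squared chord integral is a polynomial in
  \<open>c\<close> on \<open>{-w..w}\<close>, and its term in \<open>p * q\<close> is odd, hence
  absent from the result.\<close>

lemma integral_over_parallel_chords:
  fixes p q w :: real
  assumes "w > 0"
  shows "(\<integral>c. (if c\<^sup>2 \<le> w\<^sup>2 then 2 * sqrt (w\<^sup>2 - c\<^sup>2) / w\<^sup>2 * (p + c * q / w\<^sup>2) else 0)\<^sup>2 \<partial>lborel) =
    16 / 15 * (5 * p\<^sup>2 / w + q\<^sup>2 / w ^ 3)"
proof -
  define u where "u = q / w\<^sup>2"
  define X where "X c = w\<^sup>2 * (p\<^sup>2 * c + p * u * c\<^sup>2 + u\<^sup>2 * c ^ 3 / 3)
    - (p\<^sup>2 * c ^ 3 / 3 + p * u * c ^ 4 / 2 + u\<^sup>2 * c ^ 5 / 5)" for c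
  define P where "P c = 4 / w ^ 4 * X c" for c
  have "c\<^sup>2 \<le> w\<^sup>2 \<longleftrightarrow> c \<in> {-w..w}" for c
    using assms abs_le_square_iff[of c w] by auto
  then have "(if c\<^sup>2 \<le> w\<^sup>2 then 2 * sqrt (w\<^sup>2 - c\<^sup>2) / w\<^sup>2 * (p + c * q / w\<^sup>2) else 0)\<^sup>2 =
     (4 / w ^ 4 * ((w\<^sup>2 - c\<^sup>2) * (p + c * u)\<^sup>2)) * indicator {-w..w} c" for c
    by (auto simp: power_mult_distrib power_divide u_def indicator_def)
  then have "(\<integral>c. (if c\<^sup>2 \<le> w\<^sup>2 then 2 * sqrt (w\<^sup>2 - c\<^sup>2) / w\<^sup>2 * (p + c * q / w\<^sup>2) else 0)\<^sup>2 \<partial>lborel) =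
    (\<integral>c. (4 / w ^ 4 * ((w\<^sup>2 - c\<^sup>2) * (p + c * u)\<^sup>2)) * indicator {-w..w} c \<partial>lborel)"
    by presburger
  also have "\<dots> = P w - P (-w)"
  proof (rule integral_FTC_Icc_real)
    fix c
    have "(X has_real_derivative
      w\<^sup>2 * (p\<^sup>2 + p * u * (2 * c) + u\<^sup>2 * c\<^sup>2) - (p\<^sup>2 * c\<^sup>2 + p * u * (2 * c ^ 3) + u\<^sup>2 * c ^ 4)) (at c)"
      unfolding X_def by (auto intro!: derivative_eq_intros)
    also have "w\<^sup>2 * (p\<^sup>2 + p * u * (2 * c) + u\<^sup>2 * c\<^sup>2) - (p\<^sup>2 * c\<^sup>2 + p * u * (2 * c ^ 3) + u\<^sup>2 * c ^ 4) =
      (w\<^sup>2 - c\<^sup>2) * (p + c * u)\<^sup>2"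
      by algebra
    finally show "(P has_real_derivative 4 / w ^ 4 * ((w\<^sup>2 - c\<^sup>2) * (p + c * u)\<^sup>2)) (at c)"
      unfolding P_def by (rule DERIV_cmult)
  qed (use assms in \<open>auto intro!: continuous_intros\<close>)
  \<comment> \<open>The even powers in \<open>X\<close>, which carry \<open>p * u\<close>, cancel
    between the endpoints.\<close>
  also have "\<dots> = 4 / w ^ 4 * (4 / 3 * p\<^sup>2 * w ^ 3 + 4 / 15 * u\<^sup>2 * w ^ 5)"
  proof -
    have "X w - X (- w) = 4 / 3 * p\<^sup>2 * w ^ 3 + 4 / 15 * u\<^sup>2 * w ^ 5"
      unfolding X_def by (simp add: algebra_simps eval_nat_numeral)
    then show ?thesis
      unfolding P_def right_diff_distrib[symmetric] by simp
  qed
  also have "\<dots> = 16 / 15 * (5 * p\<^sup>2 / w + q\<^sup>2 / w ^ 3)"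
    unfolding u_def using assms by (simp add: field_simps eval_nat_numeral)
  finally show ?thesis .
qed

subsection \<open>Integration over slopes\<close>

lemma tan_image_open_interval: "tan ` {- (pi / 2)<..<pi / 2} = (UNIV :: real set)"
proof -
  have "y \<in> tan ` {- (pi / 2)<..<pi / 2}" for y :: real
    using arctan_lbound[of y] arctan_ubound[of y] by (intro image_eqI[of _ _ "arctan y"]) (auto simp: tan_arctan)
  then show ?thesis by auto
qed

text \<open>Integrability and value are coupled in one equivalence. It is read from angles to slopes
  to obtain an integrable majorant, and from slopes to angles to evaluate the energy.\<close>

lemma change_of_variables_tan:
  fixes f :: "real \<Rightarrow> real"
  shows "(\<lambda>x. (1 / (cos x)\<^sup>2) * f (tan x)) absolutely_integrable_on {- (pi / 2)<..<pi / 2} \<and>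
           integral {- (pi / 2)<..<pi / 2} (\<lambda>x. (1 / (cos x)\<^sup>2) * f (tan x)) = v
     \<longleftrightarrow> f absolutely_integrable_on UNIV \<and> integral UNIV f = v"
proof -
  have "inj_on tan {- (pi / 2)<..<pi / 2 :: real}"
    by (rule inj_on_inverseI[where g = arctan]) (simp add: arctan_tan)
  moreover have "(tan has_field_derivative 1 / (cos x)\<^sup>2) (at x within {- (pi / 2)<..<pi / 2})"
    if "x \<in> {- (pi / 2)<..<pi / 2}" for x :: real
  proof -
    have "cos x > 0" using that by (intro cos_gt_zero_pi) auto
    then show ?thesis
      using DERIV_tan[of x] by (auto simp: inverse_eq_divide intro: has_field_derivative_at_within)
  qed
  ultimately show ?thesis
    using has_absolute_integral_change_of_variables_1'[of "{- (pi / 2)<..<pi / 2}" tan "\<lambda>x. 1 / (cos x)\<^sup>2" f v]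
    by (simp add: tan_image_open_interval)
qed

text \<open>Under \<open>m = tan x\<close> the integrand becomes the constant 1 on a bounded
  interval. The function serves as majorant in the slope.\<close>

lemma integrable_inverse_1_plus_square: "integrable lborel (\<lambda>m::real. 1 / (1 + m\<^sup>2))"
proof -
  have "(1 / (cos x)\<^sup>2) * (1 / (1 + (tan x)\<^sup>2)) = (1::real)" if "x \<in> {- (pi / 2)<..<pi / 2}" for x
  proof -
    have "cos x \<noteq> 0" using that cos_gt_zero_pi[of x] by auto
    then show ?thesis
      using tan_sec[of x] by (simp add: power_divide power_inverse[symmetric] inverse_eq_divide)
  qed
  then have "(\<lambda>x. (1 / (cos x)\<^sup>2) * (1 / (1 + (tan x)\<^sup>2))) absolutely_integrable_on {- (pi / 2)<..<pi / 2 :: real}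
     \<longleftrightarrow> (\<lambda>x. 1::real) absolutely_integrable_on {- (pi / 2)<..<pi / 2 :: real}"
    by (intro set_integrable_cong) auto
  moreover have "(\<lambda>x. 1::real) absolutely_integrable_on {- (pi / 2)<..<pi / 2 :: real}"
    by (simp add: set_integrable_def)
  ultimately have "(\<lambda>m::real. 1 / (1 + m\<^sup>2)) absolutely_integrable_on UNIV"
    using change_of_variables_tan[of "\<lambda>m. 1 / (1 + m\<^sup>2)"] by blast
  then show ?thesis
    by (simp add: set_integrable_def integrable_completion)
qed

section \<open>Absolute integrability of the charge product over lines\<close>

lemma nn_integral_chord_indicator:
  fixes m c :: real
  shows "(\<integral>\<^sup>+t. indicator {p. (fst p)\<^sup>2 + (snd p)\<^sup>2 < 1} (t, c + m * t) \<partial>lborel) \<le>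
     ennreal (2 / sqrt (1 + m\<^sup>2)) * indicator {- sqrt (1 + m\<^sup>2)..sqrt (1 + m\<^sup>2)} c"
proof -
  define l r where "l = sqrt (1 + m\<^sup>2 - c\<^sup>2) / (1 + m\<^sup>2)" and "r = - c * m / (1 + m\<^sup>2)"
  have pos: "1 + m\<^sup>2 > 0" by (simp add: add_pos_nonneg)
  have "(\<integral>\<^sup>+t. indicator {p. (fst p)\<^sup>2 + (snd p)\<^sup>2 < 1} (t, c + m * t) \<partial>lborel) =
    (\<integral>\<^sup>+t. indicator {t. t\<^sup>2 + (c + m * t)\<^sup>2 < 1} t \<partial>lborel)"
    by (intro nn_integral_cong) (simp add: indicator_def)
  also have "\<dots> = emeasure lborel {r - l<..<r + l}"
    unfolding chord_unit_disc l_def r_def by (rule nn_integral_indicator) simp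
  also have "\<dots> \<le> ennreal (2 / sqrt (1 + m\<^sup>2)) * indicator {- sqrt (1 + m\<^sup>2)..sqrt (1 + m\<^sup>2)} c"
  proof (cases "c\<^sup>2 \<le> 1 + m\<^sup>2")
    case True
    then have "c \<in> {- sqrt (1 + m\<^sup>2)..sqrt (1 + m\<^sup>2)}"
      using real_le_rsqrt[of "\<bar>c\<bar>" "1 + m\<^sup>2"] by auto
    \<comment> \<open>Among parallel chords the one through the centre, \<open>c = 0\<close>, is the
      longest.\<close>
    moreover have "l \<le> 1 / sqrt (1 + m\<^sup>2)"
    proof -
      have "l \<le> sqrt (1 + m\<^sup>2) / (1 + m\<^sup>2)"
        unfolding l_def using pos by (intro divide_right_mono) auto
      also have "\<dots> = 1 / sqrt (1 + m\<^sup>2)"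
        using pos by (simp add: field_simps)
      finally show ?thesis .
    qed
    moreover have "l \<ge> 0" using True by (simp add: l_def)
    ultimately show ?thesis
      by (simp add: ennreal_leI)
  next
    case False
    then have "l \<le> 0" using pos by (simp add: l_def divide_nonpos_pos)
    then have "{r - l<..<r + l} = {}" by auto
    then show ?thesis by simp
  qed
  finally show ?thesis .
qed

lemma norm_disc_charge_le:
  "norm (disc_charge \<alpha>0 \<alpha>1 \<alpha>2 p) \<le>
    (\<bar>\<alpha>0\<bar> + \<bar>\<alpha>1\<bar> + \<bar>\<alpha>2\<bar>) * indicator {p. (fst p)\<^sup>2 + (snd p)\<^sup>2 < 1} p"
proof (cases "(fst p)\<^sup>2 + (snd p)\<^sup>2 < 1")
  case True
  then have "(fst p)\<^sup>2 \<le> 1" "(snd p)\<^sup>2 \<le> 1"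
    using zero_le_power2[of "fst p"] zero_le_power2[of "snd p"] by linarith+
  then have "\<bar>fst p\<bar> \<le> 1" "\<bar>snd p\<bar> \<le> 1"
    by (simp_all add: abs_square_le_1)
  then have "\<bar>\<alpha>1 * fst p\<bar> \<le> \<bar>\<alpha>1\<bar>" "\<bar>\<alpha>2 * snd p\<bar> \<le> \<bar>\<alpha>2\<bar>"
    by (auto simp: abs_mult intro: mult_left_le)
  with True show ?thesis by (simp add: disc_charge_def)
qed (simp add: disc_charge_def)

text \<open>The product of densities is at most \<open>B^2\<close> on the disc. The integrals over
  \<open>t\<close> and \<open>s\<close> contribute at most \<open>4 / (1 + m^2)\<close>, the range
  of \<open>c\<close> has length \<open>2 * sqrt (1 + m^2)\<close>, and the weight is at most
  \<open>1 / (d * sqrt (1 + m^2))\<close>. Together this leaves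
  \<open>8 * B^2 / d * (1 / (1 + m^2))\<close>, which is integrable in \<open>m\<close>.\<close>

lemma integrable_disc_charge_lines:
  fixes a b :: real
  assumes "a > 0" "b > 0"
  shows "integrable lborel
    (\<lambda>((m, c), (t, s)). (disc_charge \<alpha>0 \<alpha>1 \<alpha>2 (t, c + m * t) * disc_charge \<alpha>0 \<alpha>1 \<alpha>2 (s, c + m * s)) *
        (1 / sqrt (a\<^sup>2 + b\<^sup>2 * m\<^sup>2)))" (is "integrable _ ?f")
proof (rule integrableI_bounded)
  define B where "B = \<bar>\<alpha>0\<bar> + \<bar>\<alpha>1\<bar> + \<bar>\<alpha>2\<bar>"
  \<comment> \<open>Chosen so that \<open>d^2 * (1 + m^2) \<le> a^2 + b^2 * m^2\<close>.\<close>
  define d where "d = min a b"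
  define D :: "(real \<times> real) set" where "D = {p. (fst p)\<^sup>2 + (snd p)\<^sup>2 < 1}"
  have D[measurable]: "D \<in> sets borel"
    unfolding D_def by measurable
  have "B \<ge> 0" by (simp add: B_def)
  have "d > 0" using assms by (simp add: d_def)
  have pos: "1 + m\<^sup>2 > 0" for m :: real by (simp add: add_pos_nonneg)
  have w: "1 / sqrt (a\<^sup>2 + b\<^sup>2 * m\<^sup>2) \<le> 1 / (d * sqrt (1 + m\<^sup>2))" for m
  proof (rule divide_left_mono)
    have "d\<^sup>2 * (1 + m\<^sup>2) = d\<^sup>2 + d\<^sup>2 * m\<^sup>2" by algebra
    also have "\<dots> \<le> a\<^sup>2 + b\<^sup>2 * m\<^sup>2"
      using assms by (intro add_mono mult_right_mono power_mono) (auto simp: d_def)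
    finally have "sqrt (d\<^sup>2 * (1 + m\<^sup>2)) \<le> sqrt (a\<^sup>2 + b\<^sup>2 * m\<^sup>2)" by simp
    then show "d * sqrt (1 + m\<^sup>2) \<le> sqrt (a\<^sup>2 + b\<^sup>2 * m\<^sup>2)"
      using \<open>d > 0\<close> by (simp add: real_sqrt_mult)
  qed (use assms \<open>d > 0\<close> pos in \<open>auto intro!: mult_pos_pos add_pos_nonneg\<close>)
  let ?I = "\<lambda>m c t. indicator D (t, c + m * t) :: ennreal"
  let ?w = "\<lambda>m. ennreal (B\<^sup>2 / (d * sqrt (1 + m\<^sup>2)))"
  show "?f \<in> borel_measurable lborel"
    by (simp add: split_beta')
  have "(\<integral>\<^sup>+z. ennreal (norm (?f z)) \<partial>lborel) =
    (\<integral>\<^sup>+m. \<integral>\<^sup>+c. \<integral>\<^sup>+t. \<integral>\<^sup>+s. ennreal (norm (?f ((m, c), (t, s)))) \<partial>lborel \<partial>lborel \<partial>lborel \<partial>lborel)"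
    by (subst nn_integral_lborel_pair_pair) (simp_all add: split_beta')
  also have "\<dots> \<le> (\<integral>\<^sup>+m. \<integral>\<^sup>+c. \<integral>\<^sup>+t. \<integral>\<^sup>+s. ?I m c t * ?I m c s * ?w m \<partial>lborel \<partial>lborel \<partial>lborel \<partial>lborel)"
  proof (intro nn_integral_mono)
    fix m c t s
    have "norm (?f ((m, c), (t, s))) \<le> ((B * indicator D (t, c + m * t)) * (B * indicator D (s, c + m * s))) * (1 / (d * sqrt (1 + m\<^sup>2)))"
      unfolding B_def D_def prod.case norm_mult
      using w[of m] \<open>d > 0\<close> assms
      by (intro mult_mono norm_disc_charge_le) (auto intro!: add_nonneg_nonneg mult_nonneg_nonneg)
    also have "\<dots> = indicator D (t, c + m * t) * indicator D (s, c + m * s) * (B\<^sup>2 / (d * sqrt (1 + m\<^sup>2)))"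
      by (simp add: power2_eq_square)
    finally have "ennreal (norm (?f ((m, c), (t, s)))) \<le>
        ennreal (indicator D (t, c + m * t) * indicator D (s, c + m * s) * (B\<^sup>2 / (d * sqrt (1 + m\<^sup>2))))"
      by (rule ennreal_leI)
    also have "\<dots> = ?I m c t * ?I m c s * ?w m"
      by (simp add: indicator_def)
    finally show "ennreal (norm (?f ((m, c), (t, s)))) \<le> ?I m c t * ?I m c s * ?w m" .
  qed
  also have "\<dots> = (\<integral>\<^sup>+m. \<integral>\<^sup>+c. (\<integral>\<^sup>+t. ?I m c t \<partial>lborel) * (\<integral>\<^sup>+t. ?I m c t \<partial>lborel) * ?w m \<partial>lborel \<partial>lborel)"
    by (simp add: nn_integral_cmult nn_integral_multc)
  also have "\<dots> \<le> (\<integral>\<^sup>+m. \<integral>\<^sup>+c. (ennreal (2 / sqrt (1 + m\<^sup>2)) * indicator {- sqrt (1 + m\<^sup>2)..sqrt (1 + m\<^sup>2)} c) *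
        (ennreal (2 / sqrt (1 + m\<^sup>2)) * indicator {- sqrt (1 + m\<^sup>2)..sqrt (1 + m\<^sup>2)} c) * ?w m \<partial>lborel \<partial>lborel)"
    unfolding D_def
    by (intro nn_integral_mono mult_mono nn_integral_chord_indicator) auto
  also have "\<dots> = (\<integral>\<^sup>+m. \<integral>\<^sup>+c. ennreal (4 * B\<^sup>2 / (d * sqrt (1 + m\<^sup>2) ^ 3)) * indicator {- sqrt (1 + m\<^sup>2)..sqrt (1 + m\<^sup>2)} c \<partial>lborel \<partial>lborel)"
    using pos \<open>d > 0\<close>
    by (intro nn_integral_cong)
       (auto simp: ennreal_mult[symmetric] less_imp_le power3_eq_cube split: split_indicator)
  also have "\<dots> = (\<integral>\<^sup>+m. ennreal (8 * B\<^sup>2 / d * (1 / (1 + m\<^sup>2))) \<partial>lborel)"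
  proof (rule nn_integral_cong)
    fix m :: real
    define W where "W = sqrt (1 + m\<^sup>2)"
    have "W > 0" "W\<^sup>2 = 1 + m\<^sup>2" using pos[of m] by (auto simp: W_def)
    have "4 * B\<^sup>2 / (d * W ^ 3) * (2 * W) = 8 * B\<^sup>2 / d * (1 / W\<^sup>2)"
      using \<open>W > 0\<close> \<open>d > 0\<close> by (simp add: field_simps eval_nat_numeral)
    then show "(\<integral>\<^sup>+c. ennreal (4 * B\<^sup>2 / (d * sqrt (1 + m\<^sup>2) ^ 3)) * indicator {- sqrt (1 + m\<^sup>2)..sqrt (1 + m\<^sup>2)} c \<partial>lborel) =
        ennreal (8 * B\<^sup>2 / d * (1 / (1 + m\<^sup>2)))"
      unfolding W_def[symmetric] \<open>W\<^sup>2 = 1 + m\<^sup>2\<close>[symmetric] using \<open>W > 0\<close> \<open>d > 0\<close>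
      by (simp add: nn_integral_cmult ennreal_mult[symmetric] del: times_divide_eq_right)
  qed
  also have "\<dots> < \<infinity>"
  proof -
    have "integrable lborel (\<lambda>m::real. 8 * B\<^sup>2 / d * (1 / (1 + m\<^sup>2)))"
      using integrable_inverse_1_plus_square by (rule integrable_mult_right)
    moreover have "AE m in lborel. 0 \<le> 8 * B\<^sup>2 / d * (1 / (1 + m\<^sup>2))"
      using pos \<open>d > 0\<close> by (auto intro!: divide_nonneg_nonneg add_nonneg_nonneg)
    ultimately show ?thesis
      by (subst nn_integral_eq_integral) auto
  qed
  finally show "(\<integral>\<^sup>+z. ennreal (norm (?f z)) \<partial>lborel) < \<infinity>" .
qed

text \<open>Fubini integrates first over \<open>(t, s)\<close>, giving the square of a chord
  integral, and then over \<open>c\<close>. Integrability of \<open>q\<close> comes out on the way;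
  the tangent substitution relies on it.\<close>

lemma
  fixes a b \<alpha>0 \<alpha>1 \<alpha>2 :: real
  assumes "a > 0" "b > 0"
  defines "q \<equiv> \<lambda>m. 16 / 15 * (5 * \<alpha>0\<^sup>2 / sqrt (1 + m\<^sup>2) + (\<alpha>2 - \<alpha>1 * m)\<^sup>2 / sqrt (1 + m\<^sup>2) ^ 3) *
    (1 / sqrt (a\<^sup>2 + b\<^sup>2 * m\<^sup>2))"
  shows integrable_disc_charge_slope: "integrable lborel q"
    and integral_disc_charge_lines: "(\<integral>((m, c), (t, s)).
        (disc_charge \<alpha>0 \<alpha>1 \<alpha>2 (t, c + m * t) * disc_charge \<alpha>0 \<alpha>1 \<alpha>2 (s, c + m * s)) *
        (1 / sqrt (a\<^sup>2 + b\<^sup>2 * m\<^sup>2)) \<partial>lborel) = (\<integral>m. q m \<partial>lborel)" (is "integral\<^sup>L _ ?f = _")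
proof -
  let ?g = "disc_charge \<alpha>0 \<alpha>1 \<alpha>2"
  define h where "h = (\<lambda>(m, c). (if c\<^sup>2 \<le> 1 + m\<^sup>2
      then 2 * sqrt (1 + m\<^sup>2 - c\<^sup>2) / (1 + m\<^sup>2) * (\<alpha>0 + c * (\<alpha>2 - \<alpha>1 * m) / (1 + m\<^sup>2)) else 0)\<^sup>2 *
      (1 / sqrt (a\<^sup>2 + b\<^sup>2 * m\<^sup>2)))"
  have [measurable]: "h \<in> borel_measurable borel"
    unfolding h_def split_beta' by measurable
  have f: "integrable (lborel \<Otimes>\<^sub>M lborel) ?f"
    using integrable_disc_charge_lines[OF assms(1,2)] by (simp add: lborel_prod)
  \<comment> \<open>Fubini supplies integrable sections only for almost every line \<open>p\<close>,
    which is enough under the outer integral.\<close>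
  have h: "AE p in lborel. (\<integral>r. ?f (p, r) \<partial>lborel) = h p"
    using lborel_pair.AE_integrable_fst'[OF f]
  proof eventually_elim
    case (elim p)
    obtain m c where p: "p = (m, c)" by fastforce
    have "(\<integral>r. ?f (p, r) \<partial>lborel) = (\<integral>t. \<integral>s. ?f (p, (t, s)) \<partial>lborel \<partial>lborel)"
      using elim by (subst lborel_pair.integral_fst') (simp_all add: lborel_prod)
    also have "\<dots> = (\<integral>t. ?g (t, c + m * t) \<partial>lborel)\<^sup>2 * (1 / sqrt (a\<^sup>2 + b\<^sup>2 * m\<^sup>2))"
      by (simp add: p power2_eq_square)
    also have "\<dots> = h p"
      unfolding integral_disc_charge_chord by (simp add: h_def p)
    finally show ?case .
  qed
  have "integrable lborel h \<longleftrightarrow> integrable lborel (\<lambda>p. \<integral>r. ?f (p, r) \<partial>lborel)"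
    using h by (intro integrable_cong_AE) (auto simp: split_beta')
  then have "integrable lborel h"
    using lborel_pair.integrable_fst'[OF f] by simp
  then have h': "integrable (lborel \<Otimes>\<^sub>M lborel) h"
    by (simp add: lborel_prod)
  have q: "(\<integral>c. h (m, c) \<partial>lborel) = q m" for m
  proof -
    have "sqrt (1 + m\<^sup>2) > 0" and W: "(sqrt (1 + m\<^sup>2))\<^sup>2 = 1 + m\<^sup>2"
      by (simp_all add: add_pos_nonneg)
    then show ?thesis
      using integral_over_parallel_chords[of "sqrt (1 + m\<^sup>2)" \<alpha>0 "\<alpha>2 - \<alpha>1 * m"]
      unfolding W by (simp only: h_def q_def prod.case integral_mult_left_zero)
  qed
  show "integrable lborel q"
    using lborel_pair.integrable_fst'[OF h'] by (simp add: q)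
  have "integral\<^sup>L lborel ?f = (\<integral>p. \<integral>r. ?f (p, r) \<partial>lborel \<partial>lborel)"
    using lborel_pair.integral_fst'[OF f] by (simp add: lborel_prod)
  also have "\<dots> = integral\<^sup>L lborel h"
    using h by (intro integral_cong_AE) (auto simp: split_beta')
  also have "\<dots> = (\<integral>m. q m \<partial>lborel)"
    using lborel_pair.integral_fst'[OF h'] by (simp add: lborel_prod q)
  finally show "integral\<^sup>L lborel ?f = (\<integral>m. q m \<partial>lborel)" .
qed

text \<open>With \<open>m = tan x\<close>, \<open>sqrt (1 + m^2)\<close> becomes
  \<open>1 / cos x\<close> and \<open>sqrt (a^2 + b^2 * m^2)\<close> becomes
  \<open>a * \<Delta> x / cos x\<close>. All powers of the cosine then cancel against the Jacobian
  \<open>1 / (cos x)^2\<close>, leaving a quadratic form in sine and cosine over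
  \<open>\<Delta> x\<close>.\<close>

lemma integral_slope_elliptic:
  fixes a b \<alpha>0 \<alpha>1 \<alpha>2 :: real
  assumes "a > b" "b > 0"
  shows "(\<integral>m. 16 / 15 * (5 * \<alpha>0\<^sup>2 / sqrt (1 + m\<^sup>2) + (\<alpha>2 - \<alpha>1 * m)\<^sup>2 / sqrt (1 + m\<^sup>2) ^ 3) *
      (1 / sqrt (a\<^sup>2 + b\<^sup>2 * m\<^sup>2)) \<partial>lborel) =
    32 / (15 * a) * ((5 * \<alpha>0\<^sup>2 + \<alpha>2\<^sup>2) * elliptic_K (eccentricity a b) +
              (\<alpha>1\<^sup>2 - \<alpha>2\<^sup>2) *
                ((elliptic_K (eccentricity a b) - elliptic_E (eccentricity a b)) /
                  (eccentricity a b)\<^sup>2))" (is "integral\<^sup>L _ ?q = _")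
proof -
  define e where "e = eccentricity a b"
  define \<Delta> where "\<Delta> x = sqrt (1 - e\<^sup>2 * (sin x)\<^sup>2)" for x
  have "b\<^sup>2 < a\<^sup>2" using assms by (intro power_strict_mono) auto
  then have e2: "e\<^sup>2 = 1 - b\<^sup>2 / a\<^sup>2" "0 < e\<^sup>2" "e\<^sup>2 < 1"
    using assms by (auto simp: e_def eccentricity_def)
  have \<Delta>_arg: "1 - e\<^sup>2 * (sin x)\<^sup>2 > 0" for x
  proof -
    have "e\<^sup>2 * (sin x)\<^sup>2 \<le> e\<^sup>2 * 1"
      using e2(2) by (intro mult_left_mono) (auto simp: abs_square_le_1)
    with e2(3) show ?thesis by linarith
  qed
  then have \<Delta>_pos: "\<Delta> x > 0" for x by (simp add: \<Delta>_def)
  have \<Delta>_sq: "(\<Delta> x)\<^sup>2 = 1 - e\<^sup>2 * (sin x)\<^sup>2" for x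
    using \<Delta>_arg[of x] by (simp add: \<Delta>_def)
  have cont: "continuous_on S \<Delta>" for S
    unfolding \<Delta>_def by (intro continuous_intros)
  define h where "h x = 16 / (15 * a) * ((5 * \<alpha>0\<^sup>2 + (\<alpha>2 * cos x - \<alpha>1 * sin x)\<^sup>2) / \<Delta> x)" for x
  have cont_h: "continuous_on S h" for S
    unfolding h_def using \<Delta>_pos by (intro continuous_intros cont) (auto simp: less_le)
  have q: "integrable lborel ?q"
    using integrable_disc_charge_slope[of a b \<alpha>0 \<alpha>2 \<alpha>1] assms by simp
  then have "?q absolutely_integrable_on UNIV"
    by (simp add: set_integrable_def integrable_completion)
  then have 1: "integral {- (pi / 2)<..<pi / 2} (\<lambda>x. 1 / (cos x)\<^sup>2 * ?q (tan x)) = integral UNIV ?q"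
    using change_of_variables_tan[of ?q "integral UNIV ?q"] by blast
  have 2: "1 / (cos x)\<^sup>2 * ?q (tan x) = h x" if "x \<in> {- (pi / 2)<..<pi / 2}" for x
  proof -
    have c: "cos x > 0" using that by (intro cos_gt_zero_pi) auto
    have W: "sqrt (1 + (tan x)\<^sup>2) = 1 / cos x"
    proof -
      have "1 + (tan x)\<^sup>2 = (1 / cos x)\<^sup>2"
        using tan_sec[of x] c by (simp add: inverse_eq_divide)
      then show ?thesis using c by simp
    qed
    have "a\<^sup>2 + b\<^sup>2 * (tan x)\<^sup>2 = (a * \<Delta> x / cos x)\<^sup>2"
    proof -
      have "(a * \<Delta> x)\<^sup>2 = a\<^sup>2 * (cos x)\<^sup>2 + b\<^sup>2 * (sin x)\<^sup>2"
        unfolding power_mult_distrib \<Delta>_sq e2 cos_squared_eq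
        using assms by (simp add: field_simps)
      then show ?thesis
        using c by (simp add: power_divide tan_def field_simps)
    qed
    then have w: "sqrt (a\<^sup>2 + b\<^sup>2 * (tan x)\<^sup>2) = a * \<Delta> x / cos x"
      using assms c \<Delta>_pos[of x] by simp
    have "\<alpha>2 - \<alpha>1 * tan x = (\<alpha>2 * cos x - \<alpha>1 * sin x) / cos x"
      using c by (simp add: tan_def field_simps)
    moreover have "1 / C\<^sup>2 * (16 / 15 * (5 * \<alpha>0\<^sup>2 / (1 / C) + (S / C)\<^sup>2 / (1 / C) ^ 3) * (1 / (a * d / C))) =
        16 / (15 * a) * ((5 * \<alpha>0\<^sup>2 + S\<^sup>2) / d)" if "C > 0" "d > 0" for C d S :: real
    proof -
      have "5 * \<alpha>0\<^sup>2 / (1 / C) + (S / C)\<^sup>2 / (1 / C) ^ 3 = C * (5 * \<alpha>0\<^sup>2 + S\<^sup>2)"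
        using that by (simp add: field_simps eval_nat_numeral)
      then show ?thesis
        using that assms by (simp add: power2_eq_square)
    qed
    ultimately show ?thesis
      unfolding W w h_def using c \<Delta>_pos[of x] by simp
  qed
  have "integral\<^sup>L lborel ?q = integral UNIV ?q"
    by (rule integral_lborel[OF q, symmetric])
  also have "\<dots> = integral {- (pi / 2)<..<pi / 2} (\<lambda>x. 1 / (cos x)\<^sup>2 * ?q (tan x))"
    by (rule 1[symmetric])
  also have "\<dots> = integral {- (pi / 2)<..<pi / 2} h"
    by (rule integral_cong) (rule 2)
  also have "\<dots> = integral {- (pi / 2)..pi / 2} h"
    by (rule integral_open_interval_real[symmetric])
  \<comment> \<open>The interval is folded at 0 onto \<open>{0..pi / 2}\<close>, the range of the
    elliptic integrals.\<close>
  also have "\<dots> = integral {- (pi / 2)..0} h + integral {0..pi / 2} h"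
    by (rule Henstock_Kurzweil_Integration.integral_combine[symmetric])
       (auto intro!: integrable_continuous_real cont_h)
  also have "integral {- (pi / 2)..0} h = integral {0..pi / 2} (\<lambda>x. h (- x))"
    using Henstock_Kurzweil_Integration.integral_reflect_real[of "pi / 2" 0 "\<lambda>x. h (- x)"] by simp
  also have "\<dots> + integral {0..pi / 2} h = integral {0..pi / 2} (\<lambda>x. h (- x) + h x)"
    by (rule Henstock_Kurzweil_Integration.integral_add[symmetric])
       (auto intro!: integrable_continuous_real continuous_intros cont_h
          continuous_on_compose2[OF cont_h[of UNIV]])
  \<comment> \<open>The mixed term in \<alpha>1 \<alpha>2 is odd in \<open>x\<close> and cancels;
    the squares are expressed through \<open>(sin x)^2\<close> alone.\<close>
  also have "(\<lambda>x. h (- x) + h x) =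
     (\<lambda>x. 32 / (15 * a) * ((5 * \<alpha>0\<^sup>2 + \<alpha>2\<^sup>2) * (1 / \<Delta> x) + (\<alpha>1\<^sup>2 - \<alpha>2\<^sup>2) * ((1 / \<Delta> x - \<Delta> x) / e\<^sup>2)))"
  proof
    fix x
    \<comment> \<open>Since \<open>e^2 * (sin x)^2 = 1 - (\<Delta> x)^2\<close>, this quotient is
      what produces \<open>(K - E) / e^2\<close>. Division by \<open>e^2\<close> is legitimate
      because \<open>a > b\<close>.\<close>
    have *: "(1 / \<Delta> x - \<Delta> x) / e\<^sup>2 = (sin x)\<^sup>2 / \<Delta> x"
    proof -
      have "1 / \<Delta> x - \<Delta> x = (1 - (\<Delta> x)\<^sup>2) / \<Delta> x"
        using \<Delta>_pos[of x] by (simp add: field_simps power2_eq_square)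
      then show ?thesis
        using e2(2) by (simp add: \<Delta>_sq)
    qed
    have "(5 * \<alpha>0\<^sup>2 + (\<alpha>2 * cos x - \<alpha>1 * (- sin x))\<^sup>2) + (5 * \<alpha>0\<^sup>2 + (\<alpha>2 * cos x - \<alpha>1 * sin x)\<^sup>2) =
      2 * ((5 * \<alpha>0\<^sup>2 + \<alpha>2\<^sup>2) + (\<alpha>1\<^sup>2 - \<alpha>2\<^sup>2) * (sin x)\<^sup>2)"
      using sin_cos_squared_add[of x] by algebra
    moreover have "h (- x) + h x = 16 / (15 * a) * (((5 * \<alpha>0\<^sup>2 + (\<alpha>2 * cos x - \<alpha>1 * (- sin x))\<^sup>2) +
        (5 * \<alpha>0\<^sup>2 + (\<alpha>2 * cos x - \<alpha>1 * sin x)\<^sup>2)) / \<Delta> x)"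
      by (simp add: h_def \<Delta>_def add_divide_distrib distrib_left)
    ultimately show "h (- x) + h x = 32 / (15 * a) *
        ((5 * \<alpha>0\<^sup>2 + \<alpha>2\<^sup>2) * (1 / \<Delta> x) + (\<alpha>1\<^sup>2 - \<alpha>2\<^sup>2) * ((1 / \<Delta> x - \<Delta> x) / e\<^sup>2))"
      unfolding * by (simp add: add_divide_distrib)
  qed
  also have "integral {0..pi / 2} \<dots> = 32 / (15 * a) * ((5 * \<alpha>0\<^sup>2 + \<alpha>2\<^sup>2) * elliptic_K e +
      (\<alpha>1\<^sup>2 - \<alpha>2\<^sup>2) * ((elliptic_K e - elliptic_E e) / e\<^sup>2))"
  proof (rule integral_unique)
    have "((\<lambda>x. 1 / \<Delta> x) has_integral elliptic_K e) {0..pi / 2}"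
      unfolding elliptic_K_def \<Delta>_def[symmetric] using \<Delta>_pos
      by (intro integrable_integral integrable_continuous_real continuous_intros cont) (auto simp: less_le)
    moreover have "(\<Delta> has_integral elliptic_E e) {0..pi / 2}"
      unfolding elliptic_E_def \<Delta>_def[symmetric]
      by (intro integrable_integral integrable_continuous_real continuous_intros cont)
    ultimately show "((\<lambda>x. 32 / (15 * a) * ((5 * \<alpha>0\<^sup>2 + \<alpha>2\<^sup>2) * (1 / \<Delta> x) + (\<alpha>1\<^sup>2 - \<alpha>2\<^sup>2) * ((1 / \<Delta> x - \<Delta> x) / e\<^sup>2)))
      has_integral 32 / (15 * a) * ((5 * \<alpha>0\<^sup>2 + \<alpha>2\<^sup>2) * elliptic_K e +
      (\<alpha>1\<^sup>2 - \<alpha>2\<^sup>2) * ((elliptic_K e - elliptic_E e) / e\<^sup>2))) {0..pi / 2}"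
      by (intro has_integral_mult_right has_integral_add has_integral_divide has_integral_diff)
  qed
  finally show ?thesis unfolding e_def .
qed

subsection \<open>The energy as an integral over the unit disc\<close>

lemma borel_measurable_vector_scale:
  "(\<lambda>(p, q). vector [a * p, b * q] :: real^2) \<in> borel_measurable borel"
  by (subst borel_measurable_euclidean_space)
     (auto simp: Basis_vec_def inner_axis forall_2 split_beta' UNIV_2)

text \<open>Lebesgue measure is determined by its values on boxes, and the preimage of a box is the
  box with sides divided by \<open>a\<close> and \<open>b\<close>. The scaling also passes from
  \<open>real^2\<close> to pairs of reals.\<close>

lemma lborel_plane_scale:
  fixes a b :: real
  assumes "a > 0" "b > 0"
  shows "(lborel :: (real^2) measure) =
    density (distr lborel borel (\<lambda>(p, q). vector [a * p, b * q])) (\<lambda>_. ennreal (a * b))"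
proof (rule lborel_eqI)
  note borel_measurable_vector_scale[of a b, measurable]
  fix l u :: "real^2"
  assume "\<And>i. i \<in> Basis \<Longrightarrow> l \<bullet> i \<le> u \<bullet> i"
  from this[of "axis 1 1"] this[of "axis 2 1"]
  have le: "l $ 1 \<le> u $ 1" "l $ 2 \<le> u $ 2"
    by (simp_all add: axis_in_Basis_iff inner_axis)
  have eq: "(\<lambda>(p, q). vector [a * p, b * q] :: real^2) -` box l u =
     box (l $ 1 / a, l $ 2 / b) (u $ 1 / a, u $ 2 / b)"
    using assms by (auto simp: box_def Basis_vec_def Basis_prod_def inner_axis forall_2 field_simps)
  show "emeasure (density (distr lborel borel (\<lambda>(p, q). vector [a * p, b * q])) (\<lambda>_. ennreal (a * b))) (box l u) =
    ennreal (\<Prod>i\<in>Basis. (u - l) \<bullet> i)"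
  proof -
    have "emeasure lborel (box (l $ 1 / a, l $ 2 / b) (u $ 1 / a, u $ 2 / b)) =
        ennreal ((u $ 1 / a - l $ 1 / a) * (u $ 2 / b - l $ 2 / b))"
      using assms le
      by (subst emeasure_lborel_box) (auto simp: Basis_prod_def divide_right_mono)
    moreover have basis: "(Basis :: (real^2) set) = {axis 1 1, axis 2 1}" "axis 1 1 \<noteq> (axis 2 1 :: real^2)"
      by (auto simp: Basis_vec_def UNIV_2 axis_eq_axis)
    have "(\<Prod>i\<in>Basis. (u - l) \<bullet> i) = (u $ 1 - l $ 1) * (u $ 2 - l $ 2)"
      unfolding basis(1) using basis(2) by (subst prod.insert) (auto simp: inner_axis)
    moreover have "a * b * ((u $ 1 / a - l $ 1 / a) * (u $ 2 / b - l $ 2 / b)) = (u $ 1 - l $ 1) * (u $ 2 - l $ 2)"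
      using assms by (simp add: field_simps)
    ultimately show ?thesis
      using assms le
      by (simp add: emeasure_density nn_integral_cmult emeasure_distr eq ennreal_mult[symmetric] divide_right_mono)
  qed
qed simp

lemma integral_plane_scale:
  fixes f :: "real^2 \<Rightarrow> real" and a b :: real
  assumes [measurable]: "f \<in> borel_measurable borel" and "a > 0" "b > 0"
  shows "integral\<^sup>L lborel f = a * b * (\<integral>(p, q). f (vector [a * p, b * q]) \<partial>lborel)"
  using assms(2,3) borel_measurable_vector_scale[of a b, measurable]
  by (subst lborel_plane_scale[OF assms(2,3)])
     (simp add: integral_density integral_distr split_beta')

text \<open>Conjugation is trivial on real densities, and for Borel integrands the completed measure
  gives the same integrals as \<open>lborel\<close>. The order of integration is kept,
  \<open>y\<close> outside and \<open>x\<close> inside.\<close>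

lemma electrostatic_energy_of_real:
  fixes s :: "real^2 \<Rightarrow> real"
  assumes [measurable]: "s \<in> borel_measurable borel" "A \<in> sets borel"
  shows "electrostatic_energy A (\<lambda>x. complex_of_real (s x)) =
    complex_of_real (1 / (4 * pi) *
      (\<integral>y. \<integral>x. indicator A y * indicator A x * (s y * s x) / dist x y \<partial>lborel \<partial>lborel))"
proof -
  have inner: "(\<integral>x. indicator A x *\<^sub>R (cnj (complex_of_real (s x)) * complex_of_real (s y) /
      complex_of_real (dist x y)) \<partial>lebesgue) =
    complex_of_real (\<integral>x. indicator A x * (s x * s y / dist x y) \<partial>lborel)" for y
  proof -
    have "(\<integral>x. indicator A x *\<^sub>R (cnj (complex_of_real (s x)) * complex_of_real (s y) /
        complex_of_real (dist x y)) \<partial>lebesgue) =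
      (\<integral>x. complex_of_real (indicator A x * (s x * s y / dist x y)) \<partial>lebesgue)"
      by (rule arg_cong[where f = "integral\<^sup>L lebesgue"]) (auto simp: scaleR_conv_of_real)
    also have "\<dots> = complex_of_real (\<integral>x. indicator A x * (s x * s y / dist x y) \<partial>lborel)"
      unfolding integral_complex_of_real by (subst integral_completion) simp_all
    finally show ?thesis .
  qed
  have "electrostatic_energy A (\<lambda>x. complex_of_real (s x)) =
    (\<integral>y. complex_of_real (1 / (4 * pi) * (indicator A y * (\<integral>x. indicator A x * (s x * s y / dist x y) \<partial>lborel))) \<partial>lebesgue)"
    unfolding electrostatic_energy_def set_lebesgue_integral_def inner
    by (rule arg_cong[where f = "integral\<^sup>L lebesgue"]) (auto simp: scaleR_conv_of_real)
  also have "\<dots> = complex_of_real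
      (\<integral>y. 1 / (4 * pi) * (indicator A y * (\<integral>x. indicator A x * (s x * s y / dist x y) \<partial>lborel)) \<partial>lborel)"
    unfolding integral_complex_of_real by (subst integral_completion) simp_all
  \<comment> \<open>Constants move through either integral: a nonzero multiple of a non-integrable
    function is again non-integrable, and both integrals have the default value 0.\<close>
  also have "(\<integral>y. 1 / (4 * pi) * (indicator A y * (\<integral>x. indicator A x * (s x * s y / dist x y) \<partial>lborel)) \<partial>lborel) =
     1 / (4 * pi) * (\<integral>y. \<integral>x. indicator A y * (indicator A x * (s x * s y / dist x y)) \<partial>lborel \<partial>lborel)"
    by (simp only: integral_mult_right_zero)
  also have "(\<lambda>y x. indicator A y * (indicator A x * (s x * s y / dist x y))) =
      (\<lambda>y x. indicator A y * indicator A x * (s y * s x) / dist x y :: real)"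
    by (intro ext) simp
  finally show ?thesis .
qed

theorem theorem1p1:
  fixes a b \<alpha>0 \<alpha>1 \<alpha>2 :: real
  assumes "a > b" and "b > 0"
  shows "electrostatic_energy (elliptic_disc a b)
           (\<lambda>x. complex_of_real (affine_charge a b \<alpha>0 \<alpha>1 \<alpha>2 x)) =
         complex_of_real
           (8 * a * b\<^sup>2 / (15 * pi) *
             ((5 * \<alpha>0\<^sup>2 + \<alpha>2\<^sup>2) * elliptic_K (eccentricity a b) +
              (\<alpha>1\<^sup>2 - \<alpha>2\<^sup>2) *
                ((elliptic_K (eccentricity a b) - elliptic_E (eccentricity a b)) /
                  (eccentricity a b)\<^sup>2)))"
proof -
  have "a > 0" using assms by simp
  define A where "A = elliptic_disc a b"
  define s where "s = affine_charge a b \<alpha>0 \<alpha>1 \<alpha>2"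
  define k where "k y x = indicator A y * indicator A x * (s y * s x) / dist x y" for x y
  define T :: "real \<times> real \<Rightarrow> real^2" where "T = (\<lambda>(p, q). vector [a * p, b * q])"
  let ?g = "disc_charge \<alpha>0 \<alpha>1 \<alpha>2"
  let ?K = "\<lambda>((x1, x2), (y1, y2)). ?g (x1, x2) * ?g (y1, y2) *
    (1 / sqrt (a\<^sup>2 * (x1 - y1)\<^sup>2 + b\<^sup>2 * (x2 - y2)\<^sup>2))"
  have [measurable]: "(\<lambda>x :: real^2. x $ i) \<in> borel_measurable borel" for i
    by (intro borel_measurable_continuous_onI continuous_intros)
  have [measurable]: "s \<in> borel_measurable borel"
    unfolding s_def affine_charge_def by measurable
  have [measurable]: "A \<in> sets borel"
    unfolding A_def elliptic_disc_def by measurable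
  have [measurable]: "T \<in> borel_measurable borel"
    unfolding T_def by (rule borel_measurable_vector_scale)
  have [measurable (raw)]: "(\<lambda>z. k (f z) (g z)) \<in> borel_measurable N"
    if [measurable]: "f \<in> borel_measurable N" "g \<in> borel_measurable N" for f g and N :: "'n measure"
    unfolding k_def by measurable
  \<comment> \<open>\<open>T\<close> maps the unit disc onto the ellipse, so the pulled-back kernel
    has the form treated in line coordinates. On the diagonal both sides are 0, by division by
    zero.\<close>
  have k: "k (T u) (T v) = ?K (u, v)" for u v
  proof -
    obtain x1 x2 y1 y2 where uv: "u = (x1, x2)" "v = (y1, y2)" by fastforce
    have "dist (T v) (T u) = sqrt (a\<^sup>2 * (x1 - y1)\<^sup>2 + b\<^sup>2 * (x2 - y2)\<^sup>2)"
      by (simp add: uv T_def dist_vec_def L2_set_def sum_2 dist_real_def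
            right_diff_distrib[symmetric] power_mult_distrib power2_commute)
    moreover have "indicator A (T p) * s (T p) = ?g p" for p
      using \<open>a > 0\<close> \<open>b > 0\<close>
      by (cases p) (auto simp: A_def elliptic_disc_def T_def s_def affine_charge_def disc_charge_def
            indicator_def power_mult_distrib)
    then have "indicator A (T u) * indicator A (T v) * (s (T u) * s (T v)) = ?g u * ?g v"
      by (metis mult.assoc mult.left_commute)
    ultimately show ?thesis
      by (simp add: k_def uv)
  qed
  have G: "(\<lambda>(u, v). ?g u * ?g v) \<in> borel_measurable borel"
    unfolding split_beta' by measurable
  \<comment> \<open>Pairs of points are exchanged for lines, the chords and intercepts are
    integrated out, and the slope integral is evaluated.\<close>
  have K: "integrable lborel ?K" and K': "integral\<^sup>L lborel ?K = 32 / (15 * a) *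
      ((5 * \<alpha>0\<^sup>2 + \<alpha>2\<^sup>2) * elliptic_K (eccentricity a b) +
       (\<alpha>1\<^sup>2 - \<alpha>2\<^sup>2) *
         ((elliptic_K (eccentricity a b) - elliptic_E (eccentricity a b)) / (eccentricity a b)\<^sup>2))"
    using integrable_kernel_lines[OF G] integral_kernel_lines[OF G]
      integrable_disc_charge_lines[OF \<open>a > 0\<close> \<open>b > 0\<close>]
      integral_disc_charge_lines[OF \<open>a > 0\<close> \<open>b > 0\<close>]
      integral_slope_elliptic[OF assms]
    by (simp_all only: prod.case)
  \<comment> \<open>The scaling is applied to each of the two points separately, each time
    contributing a factor \<open>a * b\<close>.\<close>
  have "(\<integral>y. \<integral>x. k y x \<partial>lborel \<partial>lborel) = a * b * (\<integral>u. \<integral>x. k (T u) x \<partial>lborel \<partial>lborel)"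
    unfolding T_def split_beta'
    by (subst integral_plane_scale[OF _ \<open>a > 0\<close> \<open>b > 0\<close>]) (simp_all add: split_beta')
  also have "\<dots> = a * b * (\<integral>u. a * b * (\<integral>v. k (T u) (T v) \<partial>lborel) \<partial>lborel)"
  proof -
    have "(\<integral>x. k (T u) x \<partial>lborel) = a * b * (\<integral>v. k (T u) (T v) \<partial>lborel)" for u
      by (subst integral_plane_scale[OF _ \<open>a > 0\<close> \<open>b > 0\<close>]) (simp_all add: T_def split_beta')
    then show ?thesis by simp
  qed
  also have "\<dots> = (a * b)\<^sup>2 * (\<integral>u. \<integral>v. ?K (u, v) \<partial>lborel \<partial>lborel)"
    unfolding k by (simp add: power2_eq_square)
  \<comment> \<open>Only here is the iterated integral identified with the integral over pairs, by
    Fubini and the integrability \<open>K\<close>.\<close>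
  also have "(\<integral>u. \<integral>v. ?K (u, v) \<partial>lborel \<partial>lborel) = integral\<^sup>L lborel ?K"
    using K by (subst lborel_pair.integral_fst') (simp_all add: lborel_prod)
  finally have *: "(\<integral>y. \<integral>x. k y x \<partial>lborel \<partial>lborel) = (a * b)\<^sup>2 * integral\<^sup>L lborel ?K" .
  have "1 / (4 * pi) * ((a * b)\<^sup>2 * (32 / (15 * a) * v)) = 8 * a * b\<^sup>2 / (15 * pi) * v" for v
    using \<open>a > 0\<close> by (simp add: power2_eq_square)
  then have "1 / (4 * pi) * (\<integral>y. \<integral>x. k y x \<partial>lborel \<partial>lborel) = 8 * a * b\<^sup>2 / (15 * pi) *
      ((5 * \<alpha>0\<^sup>2 + \<alpha>2\<^sup>2) * elliptic_K (eccentricity a b) +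
       (\<alpha>1\<^sup>2 - \<alpha>2\<^sup>2) *
         ((elliptic_K (eccentricity a b) - elliptic_E (eccentricity a b)) / (eccentricity a b)\<^sup>2))"
    unfolding * K' .
  moreover have "electrostatic_energy A (\<lambda>x. complex_of_real (s x)) =
      complex_of_real (1 / (4 * pi) * (\<integral>y. \<integral>x. k y x \<partial>lborel \<partial>lborel))"
    unfolding k_def by (rule electrostatic_energy_of_real) measurable
  ultimately show ?thesis
    unfolding A_def s_def by (simp only:)
qed

end
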